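(* Let $\varphi:\mathbb R^n\to\mathbb R$ and $\phi:\mathbb R^n\to\mathbb R^q$, and let $\bar z$ be a local minimizer of the problem (P): $\min_z \varphi(z)$ s.t. $\phi(z)\le 0$. Suppose that $\varphi$ is continuously differentiable at $\bar z$ and that $\phi$ is directionally Lipschitz continuous and directionally differentiable at $\bar z$ in direction $u\in C(\bar z)$, where $C(\bar z)$ is the critical cone. Suppose that (P) is calm at $\bar z$ in direction $u$. Then there exists $\lambda_\phi\in\mathbb R^q$ such that $\lambda_\phi\ge 0$, $\langle\lambda_\phi,\phi(\bar z)\rangle=0$, $\langle\lambda_\phi,\phi'(\bar z;u)\rangle=0$ and $$0\in\nabla\varphi(\bar z)+\partial\langle\lambda_\phi,\phi\rangle(\bar z;u).$$
   Context: $\mathbb B$ is the open unit ball and $\|\cdot\|$ the Euclidean norm. For a direction $d$ and $\epsilon,\delta>0$ the directional neighborhood is $\mathcal V_{\epsilon,\delta}(d):=\{z\in\epsilon\mathbb B : \big\|\,\|d\|z-\|z\|d\,\big\|\le\delta\|z\|\|d\|\}$ (so for $d=0$ it is $\epsilon\mathbb B$). Directional derivative: $\phi'(z;u):=\lim_{t\downarrow0}(\phi(z+tu)-\phi(z))/t$; $\phi$ is directionally differentiable at $z$ in direction $u$ if this limit exists. $\phi$ is directionally Lipschitz continuous at $\bar z$ in direction $u$ if there are $L,\epsilon,\delta>0$ with $\|\phi(z)-\phi(z')\|\le L\|z-z'\|$ for all $z,z'\in\bar z+\mathcal V_{\epsilon,\delta}(u)$. Regular (Fréchet) subdifferential: $\widehat\partial\psi(\bar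 z)=\{\xi: \psi(z)\ge\psi(\bar z)+\langle\xi,z-\bar z\rangle+o(\|z-\bar z\|)\}$. Directional limiting subdifferential: $\partial\psi(\bar z;u)=\{\xi:\exists t_k\downarrow0,u^k\to u,\xi^k\to\xi \text{ with } \psi(\bar z+t_ku^k)\to\psi(\bar z),\ \xi^k\in\widehat\partial\psi(\bar z+t_ku^k)\}$. Active set: $I_\phi(\bar z)=\{j:\phi_j(\bar z)=0\}$. Critical cone: $u\in C(\bar z)$ means $\phi_j'(\bar z;u)\le0$ for all $j\in I_\phi(\bar z)$ and $\nabla\varphi(\bar z)u\le0$. Directional (Clarke) calmness: (P) is calm at its solution $\bar z$ in direction $u$ if there exist $\epsilon,\delta,\rho>0$ such that for any $\alpha\in\epsilon\mathbb B\subseteq\mathbb R^q$ and any $z\in\bar z+\mathcal V_{\epsilon,\delta}(u)$ with $\phi(z)+\alpha\le0$ one has $\varphi(z)-\varphi(\bar z)+\rho\|\alpha\|\ge0$. *)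

theory Defs
  imports "HOL-Analysis.Analysis" "HOL-Library.Landau_Symbols"
begin

definition dir_nhd :: "real \<Rightarrow> real \<Rightarrow> 'a::real_normed_vector \<Rightarrow> 'a set" where
  "dir_nhd \<epsilon> \<delta> d = {z \<in> ball 0 \<epsilon>. norm (norm d *\<^sub>R z - norm z *\<^sub>R d) \<le> \<delta> * norm z * norm d}"

definition dir_differentiable ::
    "('a::real_normed_vector \<Rightarrow> 'b::real_normed_vector) \<Rightarrow> 'a \<Rightarrow> 'a \<Rightarrow> bool" where
  "dir_differentiable f z u \<longleftrightarrow>
     (\<exists>d. ((\<lambda>t::real. (f (z + t *\<^sub>R u) - f z) /\<^sub>R t) \<longlongrightarrow> d) (at_right 0))"

text \<open>The value of \<open>Lim\<close> is meaningful only if \<^const>\<open>dir_differentiable\<close> holds;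
  likewise \<open>gradient\<close> below presupposes differentiability.\<close>

definition dir_deriv ::
    "('a::real_normed_vector \<Rightarrow> 'b::real_normed_vector) \<Rightarrow> 'a \<Rightarrow> 'a \<Rightarrow> 'b" where
  "dir_deriv f z u = Lim (at_right 0) (\<lambda>t::real. (f (z + t *\<^sub>R u) - f z) /\<^sub>R t)"

definition dir_lipschitz ::
    "('a::real_normed_vector \<Rightarrow> 'b::real_normed_vector) \<Rightarrow> 'a \<Rightarrow> 'a \<Rightarrow> bool" where
  "dir_lipschitz f zb u \<longleftrightarrow>
     (\<exists>L>0. \<exists>\<epsilon>>0. \<exists>\<delta>>0. \<forall>z \<in> (+) zb ` dir_nhd \<epsilon> \<delta> u. \<forall>z' \<in> (+) zb ` dir_nhd \<epsilon> \<delta> u.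
        norm (f z - f z') \<le> L * norm (z - z'))"

definition gradient :: "('a::real_inner \<Rightarrow> real) \<Rightarrow> 'a \<Rightarrow> 'a" where
  "gradient f z = (THE g. GDERIV f z :> g)"

text \<open>Continuity of the gradient is required at the point \<open>z\<close> only, not on a neighbourhood.\<close>

definition cont_differentiable_at :: "('a::euclidean_space \<Rightarrow> real) \<Rightarrow> 'a \<Rightarrow> bool" where
  "cont_differentiable_at f z \<longleftrightarrow>
     (\<forall>\<^sub>F x in nhds z. f differentiable (at x)) \<and> isCont (gradient f) z"

definition regular_subdiff :: "('a::real_inner \<Rightarrow> real) \<Rightarrow> 'a \<Rightarrow> 'a set" where
  "regular_subdiff \<psi> zb =
     {\<xi>. \<exists>r \<in> o[at zb](\<lambda>z. norm (z - zb)).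
            \<forall>\<^sub>F z in at zb. \<psi> z \<ge> \<psi> zb + \<xi> \<bullet> (z - zb) + r z}"

definition dir_limiting_subdiff :: "('a::real_inner \<Rightarrow> real) \<Rightarrow> 'a \<Rightarrow> 'a \<Rightarrow> 'a set" where
  "dir_limiting_subdiff \<psi> zb u =
     {\<xi>. \<exists>(t :: nat \<Rightarrow> real) (v :: nat \<Rightarrow> 'a) (\<eta> :: nat \<Rightarrow> 'a).
            (\<forall>k. t k > 0) \<and> t \<longlonglongrightarrow> 0 \<and> v \<longlonglongrightarrow> u \<and> \<eta> \<longlonglongrightarrow> \<xi> \<and>
            (\<lambda>k. \<psi> (zb + t k *\<^sub>R v k)) \<longlonglongrightarrow> \<psi> zb \<and>
            (\<forall>k. \<eta> k \<in> regular_subdiff \<psi> (zb + t k *\<^sub>R v k))}"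

text \<open>The problem (P) is: minimize \<open>f z\<close> subject to \<open>\<phi> z \<le> 0\<close>. The order on
  \<open>real ^ 'q\<close> is the componentwise one.\<close>

definition local_minimizer ::
    "('a::real_normed_vector \<Rightarrow> real) \<Rightarrow> ('a \<Rightarrow> real ^ 'q) \<Rightarrow> 'a \<Rightarrow> bool" where
  "local_minimizer f \<phi> zb \<longleftrightarrow>
     \<phi> zb \<le> 0 \<and> (\<exists>e>0. \<forall>z \<in> ball zb e. \<phi> z \<le> 0 \<longrightarrow> f zb \<le> f z)"

definition active_set :: "('a \<Rightarrow> real ^ 'q) \<Rightarrow> 'a \<Rightarrow> 'q set" where
  "active_set \<phi> zb = {j. \<phi> zb $ j = 0}"

definition critical_cone ::
    "('a::real_inner \<Rightarrow> real) \<Rightarrow> ('a \<Rightarrow> real ^ 'q) \<Rightarrow> 'a \<Rightarrow> 'a set" where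
  "critical_cone f \<phi> zb =
     {u. (\<forall>j \<in> active_set \<phi> zb. dir_deriv (\<lambda>z. \<phi> z $ j) zb u \<le> 0) \<and> gradient f zb \<bullet> u \<le> 0}"

definition dir_calm ::
    "('a::real_normed_vector \<Rightarrow> real) \<Rightarrow> ('a \<Rightarrow> real ^ 'q) \<Rightarrow> 'a \<Rightarrow> 'a \<Rightarrow> bool" where
  "dir_calm f \<phi> zb u \<longleftrightarrow>
     (\<exists>\<epsilon>>0. \<exists>\<delta>>0. \<exists>\<rho>>0. \<forall>\<alpha> \<in> ball 0 \<epsilon>. \<forall>z \<in> (+) zb ` dir_nhd \<epsilon> \<delta> u.
        \<phi> z + \<alpha> \<le> 0 \<longrightarrow> f z - f zb + \<rho> * norm \<alpha> \<ge> 0)"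

end

theory Submission
  imports Defs
begin

text \<open>Calmness says that \<open>zb\<close> minimizes the exact penalty function \<open>f + \<rho> |\<phi>\<^sub>+|\<close> on a directional
  neighbourhood. Replace \<open>|y\<^sub>+|\<close> by the smooth penalty \<open>sqrt (s\<^sup>2 + |y\<^sub>+|\<^sup>2)\<close> with \<open>s = t\<^sup>2\<close> and \<open>f\<close> by
  its linearization at \<open>zb\<close>. Since \<open>u\<close> is critical, \<open>zb + t u\<close> then minimizes up to \<open>o(t)\<close> on balls
  of radius \<open>\<eta> t\<close>, and a quadratic localizer turns this into an exact minimizer \<open>z\<close> of a slightly
  tilted function. The gradient of the smooth penalty at \<open>\<phi> z\<close> is a multiplier \<open>l\<close>, and because the
  penalty is smooth and \<open>\<phi>\<close> is Lipschitz near \<open>z\<close>, the minimality yields a proximal subgradient of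
  \<open>l \<bullet> \<phi>\<close> at \<open>z\<close> close to \<open>- gradient f zb\<close>. As \<open>t\<close> tends to 0 the bounded multipliers
  subconverge to some \<open>l'\<close>; since \<open>(l' - l) \<bullet> \<phi>\<close> has a small Lipschitz constant, the same localizer on
  a tiny ball replaces \<open>l\<close> by \<open>l'\<close>. Complementarity holds because \<open>l $ j\<close> vanishes unless
  \<open>\<phi> z $ j > 0\<close>.\<close>

section \<open>Quadratic localization and proximal subgradients\<close>

text \<open>Minimize \<open>\<psi> x + a * (norm (x - c))^2\<close> over the ball with
  \<open>a = 2 * m / r^2\<close>. On the bounding sphere the added term equals \<open>2 * m\<close>,
  more than the possible gain \<open>m\<close>, so the minimizer \<open>z\<close> is interior.
  Expanding the square about \<open>z\<close> turns minimality into the proximal inequality with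
  slope \<open>w = - 2 * a * (z - c)\<close>, whose norm is at most
  \<open>2 * a * r\<close>.\<close>

lemma approx_minimum_imp_proximal_subgradient:
  fixes \<psi> :: "'a::euclidean_space \<Rightarrow> real"
  assumes cont: "continuous_on (cball c r) \<psi>" and r: "r > 0" and m: "m > 0"
    and gap: "\<And>z. z \<in> cball c r \<Longrightarrow> \<psi> c - m \<le> \<psi> z"
  obtains z w a where "z \<in> ball c r" "norm w \<le> 4 * m / r"
    "\<And>x. x \<in> cball c r \<Longrightarrow> \<psi> x \<ge> \<psi> z + w \<bullet> (x - z) - a * (norm (x - z))\<^sup>2"
proof -
  define a where "a = 2 * m / r\<^sup>2"
  have a: "a > 0" using r m by (simp add: a_def)
  have "continuous_on (cball c r) (\<lambda>x. \<psi> x + a * (norm (x - c))\<^sup>2)"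
    by (intro continuous_intros cont)
  then obtain z where z: "z \<in> cball c r"
    and zmin: "\<And>x. x \<in> cball c r \<Longrightarrow> \<psi> z + a * (norm (z - c))\<^sup>2 \<le> \<psi> x + a * (norm (x - c))\<^sup>2"
    using continuous_attains_inf[OF compact_cball, of c r] r by fastforce
  have "a * (norm (z - c))\<^sup>2 \<le> m"
    using zmin[of c] gap[OF z] r by simp
  also have "m < a * r\<^sup>2"
    using r m by (simp add: a_def)
  finally have "(norm (z - c))\<^sup>2 < r\<^sup>2"
    using a by simp
  then have zr: "norm (z - c) < r"
    using r by (simp add: power_less_imp_less_base)
  define w where "w = - (2 * a) *\<^sub>R (z - c)"
  have "norm w = 2 * a * norm (z - c)"
    using a by (simp add: w_def)
  also have "\<dots> \<le> 2 * a * r"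
    using zr a by simp
  also have "\<dots> = 4 * m / r"
    using r by (simp add: a_def power2_eq_square)
  finally have w: "norm w \<le> 4 * m / r" .
  have "\<psi> x \<ge> \<psi> z + w \<bullet> (x - z) - a * (norm (x - z))\<^sup>2" if "x \<in> cball c r" for x
  proof -
    have "(norm (x - c))\<^sup>2 = (norm (z - c))\<^sup>2 + 2 * ((z - c) \<bullet> (x - z)) + (norm (x - z))\<^sup>2"
      unfolding power2_norm_eq_inner by (simp add: algebra_simps inner_commute)
    then have "a * (norm (x - c))\<^sup>2 = a * (norm (z - c))\<^sup>2 - w \<bullet> (x - z) + a * (norm (x - z))\<^sup>2"
      by (simp add: w_def distrib_left)
    then show ?thesis
      using zmin[OF that] by linarith
  qed
  moreover have "z \<in> ball c r"
    using zr by (simp add: dist_norm norm_minus_commute)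
  ultimately show thesis
    using that w by blast
qed

text \<open>Divided by \<open>norm (x - z)\<close>, the quadratic term tends to 0, so it is an
  admissible remainder in \<open>regular_subdiff\<close>, whatever the sign of
  \<open>a\<close>.\<close>

lemma regular_subdiff_proximalI:
  fixes \<psi> :: "'a::real_inner \<Rightarrow> real"
  assumes "r > 0"
    and prox: "\<And>x. x \<in> ball z r \<Longrightarrow> \<psi> x \<ge> \<psi> z + \<xi> \<bullet> (x - z) - a * (norm (x - z))\<^sup>2"
  shows "\<xi> \<in> regular_subdiff \<psi> z"
proof -
  have "((\<lambda>x. - a * norm (x - z)) \<longlongrightarrow> - a * norm (z - z)) (at z)"
    by (intro tendsto_intros)
  then have "((\<lambda>x. - a * norm (x - z)) \<longlongrightarrow> 0) (at z)"
    by simp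
  then have "((\<lambda>x. - a * (norm (x - z))\<^sup>2 / norm (x - z)) \<longlongrightarrow> 0) (at z)"
    by (rule Lim_transform_eventually)
      (auto simp: eventually_at_filter power2_eq_square intro!: always_eventually)
  then have "(\<lambda>x. - a * (norm (x - z))\<^sup>2) \<in> o[at z](\<lambda>x. norm (x - z))"
    by (rule smalloI_tendsto) (simp add: eventually_at_filter)
  moreover have "\<forall>\<^sub>F x in at z. \<psi> x \<ge> \<psi> z + \<xi> \<bullet> (x - z) + (- a * (norm (x - z))\<^sup>2)"
    using eventually_at_ball[OF \<open>r > 0\<close>, of z UNIV]
    by eventually_elim (use prox in fastforce)
  ultimately show ?thesis
    unfolding regular_subdiff_def
    by (intro CollectI bexI[where x = "\<lambda>x. - a * (norm (x - z))\<^sup>2"])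
qed

text \<open>Replacing \<open>l\<close> by \<open>l'\<close> adds
  \<open>(l' - l) \<bullet> \<phi>\<close>, which has Lipschitz constant
  \<open>L * norm (l' - l)\<close>. On a ball of radius \<open>R\<close>, \<open>z\<close> therefore
  minimizes \<open>l' \<bullet> \<phi> x - \<xi> \<bullet> x\<close> up to a gap \<open>m\<close>
  proportional to \<open>R\<close>. The localizer tilts by at most \<open>4 * m / R\<close>, which
  does not depend on \<open>R\<close>, so \<open>R\<close> may be taken as small as desired.\<close>

lemma proximal_change_multiplier:
  fixes \<phi> :: "'a::euclidean_space \<Rightarrow> 'b::real_inner"
  assumes r: "r > 0" and e: "e > 0" and L: "L > 0"
    and lip: "\<And>x y. x \<in> cball z r \<Longrightarrow> y \<in> cball z r \<Longrightarrow> norm (\<phi> x - \<phi> y) \<le> L * norm (x - y)"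
    and prox: "\<And>x. x \<in> cball z r \<Longrightarrow>
      l \<bullet> \<phi> x \<ge> l \<bullet> \<phi> z + \<xi> \<bullet> (x - z) - a * (norm (x - z))\<^sup>2"
  obtains z' \<xi>' where "z' \<in> cball z r" "norm (z' - z) \<le> e"
    "norm (\<xi>' - \<xi>) \<le> e + 4 * L * norm (l' - l)" "\<xi>' \<in> regular_subdiff (\<lambda>x. l' \<bullet> \<phi> x) z'"
proof -
  \<comment> \<open>The last bound keeps the quadratic error \<open>a * R^2\<close> below
    \<open>e / 4 * R\<close>; the summand 1 covers \<open>a = 0\<close>.\<close>
  define R where "R = min r (min e (e / (4 * (\<bar>a\<bar> + 1))))"
  have R: "R > 0" "R \<le> r" "R \<le> e" "R \<le> e / (4 * (\<bar>a\<bar> + 1))"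
    using r e by (auto simp: R_def)
  have aR: "\<bar>a\<bar> * R \<le> e / 4"
  proof -
    have "(\<bar>a\<bar> + 1) * R \<le> e / 4" using R(4) by (simp add: field_simps)
    then show ?thesis using R(1) by (simp add: algebra_simps)
  qed
  define m where "m = (e / 4 + L * norm (l' - l)) * R"
  have m: "m > 0"
    unfolding m_def using R e L by (intro mult_pos_pos add_pos_nonneg) auto
  define \<psi> where "\<psi> = (\<lambda>x. l' \<bullet> \<phi> x - \<xi> \<bullet> x)"
  have sub: "cball z R \<subseteq> cball z r" using R by auto
  have "L-lipschitz_on (cball z r) \<phi>"
    using lip L by (intro lipschitz_onI) (auto simp: dist_norm)
  then have "continuous_on (cball z R) \<phi>"
    using sub lipschitz_on_continuous_on continuous_on_subset by blast
  then have cont: "continuous_on (cball z R) \<psi>"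
    unfolding \<psi>_def by (intro continuous_intros)
  have gap: "\<psi> z - m \<le> \<psi> x" if x: "x \<in> cball z R" for x
  proof -
    have xR: "norm (x - z) \<le> R" using x by (simp add: dist_norm norm_minus_commute)
    have xr: "x \<in> cball z r" using x sub by auto
    have "\<bar>(l' - l) \<bullet> (\<phi> x - \<phi> z)\<bar> \<le> norm (l' - l) * norm (\<phi> x - \<phi> z)"
      by (rule Cauchy_Schwarz_ineq2)
    also have "\<dots> \<le> norm (l' - l) * (L * R)"
    proof (intro mult_left_mono)
      have "norm (\<phi> x - \<phi> z) \<le> L * norm (x - z)" using lip[OF xr] r by simp
      also have "\<dots> \<le> L * R" using xR L by simp
      finally show "norm (\<phi> x - \<phi> z) \<le> L * R" .
    qed simp
    finally have 1: "(l' - l) \<bullet> (\<phi> x - \<phi> z) \<ge> - (norm (l' - l) * (L * R))" by linarith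
    have "a * (norm (x - z))\<^sup>2 \<le> \<bar>a\<bar> * R\<^sup>2"
      using xR by (intro mult_mono power_mono) auto
    also have "\<dots> = (\<bar>a\<bar> * R) * R" by (simp add: power2_eq_square)
    also have "\<dots> \<le> e / 4 * R" using aR R by (intro mult_right_mono) auto
    finally have 2: "a * (norm (x - z))\<^sup>2 \<le> e / 4 * R" .
    show ?thesis
      using prox[OF xr] 1 2 unfolding \<psi>_def m_def by (simp add: algebra_simps)
  qed
  obtain z' w b where z': "z' \<in> ball z R" and w: "norm w \<le> 4 * m / R"
    and min: "\<And>x. x \<in> cball z R \<Longrightarrow> \<psi> x \<ge> \<psi> z' + w \<bullet> (x - z') - b * (norm (x - z'))\<^sup>2"
    using approx_minimum_imp_proximal_subgradient[OF cont R(1) m gap] by metis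
  obtain d where d: "d > 0" "ball z' d \<subseteq> ball z R"
    using z' open_ball[of z R] by (meson open_contains_ball)
  have "\<xi> + w \<in> regular_subdiff (\<lambda>x. l' \<bullet> \<phi> x) z'"
  proof (rule regular_subdiff_proximalI[OF d(1)])
    fix x assume "x \<in> ball z' d"
    then have "x \<in> cball z R" using d by auto
    from min[OF this]
    show "l' \<bullet> \<phi> x \<ge> l' \<bullet> \<phi> z' + (\<xi> + w) \<bullet> (x - z') - b * (norm (x - z'))\<^sup>2"
      by (simp add: \<psi>_def algebra_simps)
  qed
  moreover have "norm (\<xi> + w - \<xi>) \<le> e + 4 * L * norm (l' - l)"
    using w R(1) by (simp add: m_def)
  moreover have "z' \<in> cball z r" "norm (z' - z) \<le> e"
    using z' R by (auto simp: dist_norm norm_minus_commute)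
  ultimately show thesis
    using that by blast
qed

section \<open>The smoothed penalty on the constraint space\<close>

definition pos_vec :: "real ^ 'q \<Rightarrow> real ^ 'q" where
  "pos_vec y = (\<chi> j. max (y $ j) 0)"

text \<open>\<open>norm (pos_vec y)\<close> is the Euclidean distance from \<open>y\<close> to the
  nonpositive orthant. Its square is already continuously differentiable; \<open>s^2\<close> under
  the root removes the kink that the distance has at the boundary of the orthant.\<close>

definition smooth_penalty :: "real \<Rightarrow> real ^ 'q \<Rightarrow> real" where
  "smooth_penalty s y = sqrt (s\<^sup>2 + (norm (pos_vec y))\<^sup>2)"

lemma pos_vec_nth [simp]: "pos_vec y $ j = max (y $ j) 0"
  by (simp add: pos_vec_def)

lemma pos_vec_ge: "y \<le> pos_vec y"
  by (simp add: less_eq_vec_def)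

lemma norm_pos_vec_le_diff:
  assumes "y' \<le> 0"
  shows "norm (pos_vec y) \<le> norm (y - y')"
proof (rule norm_le_componentwise_cart)
  fix j
  have "y' $ j \<le> 0" using assms by (simp add: less_eq_vec_def)
  then show "norm (pos_vec y $ j) \<le> norm ((y - y') $ j)" by auto
qed

text \<open>This is the descent estimate for the squared distance to the orthant, whose gradient
  \<open>2 * pos_vec y\<close> is Lipschitz with constant 2. It reduces to a scalar inequality in
  each coordinate.\<close>

lemma norm_pos_vec_square_upper:
  "(norm (pos_vec y'))\<^sup>2 \<le>
    (norm (pos_vec y))\<^sup>2 + 2 * (pos_vec y \<bullet> (y' - y)) + (norm (y' - y))\<^sup>2"
proof -
  have "(max b 0)\<^sup>2 \<le> (max a 0)\<^sup>2 + 2 * (max a 0 * (b - a)) + (b - a)\<^sup>2" for a b :: real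
  proof (cases "a \<ge> 0")
    case True
    then show ?thesis by (auto simp: max_def power2_eq_square algebra_simps)
  next
    case False
    then have "(max b 0)\<^sup>2 \<le> (b - a)\<^sup>2"
      by (cases "b \<ge> 0") (auto intro: power_mono)
    then show ?thesis using False by simp
  qed
  then show ?thesis
    unfolding power2_norm_eq_inner inner_vec_def sum_distrib_left sum.distrib[symmetric]
    by (intro sum_mono) (simp add: power2_eq_square)
qed

lemma smooth_penalty_ge: "norm (pos_vec y) \<le> smooth_penalty s y"
  by (simp add: smooth_penalty_def real_le_rsqrt)

lemma smooth_penalty_le: "s \<ge> 0 \<Longrightarrow> smooth_penalty s y \<le> s + norm (pos_vec y)"
  by (simp add: smooth_penalty_def sqrt_sum_squares_le_sum)

lemma smooth_penalty_ge_parameter: "s \<ge> 0 \<Longrightarrow> s \<le> smooth_penalty s y"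
  by (simp add: smooth_penalty_def real_le_rsqrt)

text \<open>A quadratic upper model: \<open>pos_vec y /\<^sub>R smooth_penalty s y\<close> is the
  gradient at \<open>y\<close>, and the constant \<open>1 / (2 * s)\<close> comes from
  \<open>s \<le> smooth_penalty s y\<close>. Its growth as \<open>s\<close> tends to 0 is harmless,
  since it only enters the coefficient \<open>a\<close> of a proximal inequality.\<close>

lemma smooth_penalty_upper:
  assumes "s > 0"
  shows "smooth_penalty s y' \<le> smooth_penalty s y
    + (pos_vec y /\<^sub>R smooth_penalty s y) \<bullet> (y' - y) + (norm (y' - y))\<^sup>2 / (2 * s)"
proof -
  let ?P = "smooth_penalty s y" and ?P' = "smooth_penalty s y'"
  have P: "?P \<ge> s" "?P > 0"
    using assms smooth_penalty_ge_parameter[of s y] by auto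
  txt \<open>AM-GM removes the square root from the left-hand side.\<close>
  have "2 * ?P * ?P' \<le> ?P\<^sup>2 + ?P'\<^sup>2"
    using sum_squares_bound[of ?P ?P'] by simp
  also have "?P'\<^sup>2 = s\<^sup>2 + (norm (pos_vec y'))\<^sup>2"
    by (simp add: smooth_penalty_def)
  also have "\<dots> \<le> s\<^sup>2 + ((norm (pos_vec y))\<^sup>2 + 2 * (pos_vec y \<bullet> (y' - y)) + (norm (y' - y))\<^sup>2)"
    using norm_pos_vec_square_upper by (intro add_left_mono)
  also have "\<dots> = ?P\<^sup>2 + 2 * (pos_vec y \<bullet> (y' - y)) + (norm (y' - y))\<^sup>2"
    by (simp add: smooth_penalty_def)
  finally have "2 * ?P * ?P' \<le> 2 * ?P\<^sup>2 + 2 * (pos_vec y \<bullet> (y' - y)) + (norm (y' - y))\<^sup>2"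
    by linarith
  then have "?P' \<le> ?P + (pos_vec y \<bullet> (y' - y)) / ?P + (norm (y' - y))\<^sup>2 / (2 * ?P)"
    using P by (simp add: field_simps power2_eq_square)
  also have "(norm (y' - y))\<^sup>2 / (2 * ?P) \<le> (norm (y' - y))\<^sup>2 / (2 * s)"
    using P assms by (intro divide_left_mono) auto
  finally show ?thesis
    unfolding inner_scaleR_left divide_inverse_commute[of _ ?P] by simp
qed

section \<open>Directional neighbourhoods and exact penalization\<close>

lemma cone_subset_dir_nhd:
  fixes u :: "'a::real_normed_vector"
  assumes "\<epsilon> > 0" "\<delta> > 0"
  obtains \<kappa> T where "\<kappa> > 0" "T > 0"
    "\<And>t y. 0 < t \<Longrightarrow> t < T \<Longrightarrow> norm (y - t *\<^sub>R u) \<le> \<kappa> * t \<Longrightarrow> y \<in> dir_nhd \<epsilon> \<delta> u"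
proof -
  \<comment> \<open>With \<open>y = t *\<^sub>R u + e\<close>, the cone condition follows from
    \<open>2 * norm e \<le> \<delta> * (t * norm u - norm e)\<close>; solving for
    \<open>norm e\<close> gives this \<open>\<kappa>\<close>. For \<open>u = 0\<close> the
    neighbourhood is a full ball and any positive value serves.\<close>
  define \<kappa> where "\<kappa> = (if u = 0 then 1 else \<delta> * norm u / (2 + \<delta>))"
  define T where "T = \<epsilon> / (norm u + \<kappa>)"
  have \<kappa>: "\<kappa> > 0" using assms by (auto simp: \<kappa>_def intro!: divide_pos_pos add_pos_pos)
  have nk: "norm u + \<kappa> > 0" using \<kappa> by (simp add: add_nonneg_pos)
  have T: "T > 0" using assms nk by (simp add: T_def)
  have "y \<in> dir_nhd \<epsilon> \<delta> u" if t: "0 < t" "t < T" and y: "norm (y - t *\<^sub>R u) \<le> \<kappa> * t" for t y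
  proof -
    define e where "e = y - t *\<^sub>R u"
    have ye: "y = t *\<^sub>R u + e" and e: "norm e \<le> \<kappa> * t" using y by (auto simp: e_def)
    have "norm y \<le> norm (t *\<^sub>R u) + norm e" unfolding ye by (rule norm_triangle_ineq)
    also have "\<dots> \<le> t * (norm u + \<kappa>)" using e t by (simp add: algebra_simps)
    also have "\<dots> < \<epsilon>" using t nk by (simp add: T_def field_simps)
    finally have small: "norm y < \<epsilon>" .
    have "norm (norm u *\<^sub>R y - norm y *\<^sub>R u) \<le> \<delta> * norm y * norm u"
    proof (cases "u = 0")
      case False
      have "norm u *\<^sub>R y - norm y *\<^sub>R u = norm u *\<^sub>R e + (norm (t *\<^sub>R u) - norm y) *\<^sub>R u"
        using t by (simp add: ye algebra_simps)
      also have "norm \<dots> \<le> norm u * norm e + \<bar>norm (t *\<^sub>R u) - norm y\<bar> * norm u"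
        by (rule order_trans[OF norm_triangle_ineq]) simp
      also have "\<bar>norm (t *\<^sub>R u) - norm y\<bar> \<le> norm e"
        using norm_triangle_ineq3[of "t *\<^sub>R u" y] by (simp add: ye)
      finally have 1: "norm (norm u *\<^sub>R y - norm y *\<^sub>R u) \<le> 2 * norm e * norm u"
        by (simp add: mult_right_mono algebra_simps)
      have "norm y \<ge> t * norm u - norm e"
        using norm_triangle_ineq3[of "t *\<^sub>R u" y] t by (simp add: ye)
      then have 2: "\<delta> * norm y \<ge> \<delta> * (t * norm u - norm e)"
        using assms by simp
      have "(2 + \<delta>) * norm e \<le> (2 + \<delta>) * (\<kappa> * t)"
        using e assms by (intro mult_left_mono) auto
      also have "\<dots> = \<delta> * norm u * t"
        using False assms by (simp add: \<kappa>_def)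
      finally have "2 * norm e \<le> \<delta> * norm y" using 2 by (simp add: algebra_simps)
      then have "2 * norm e * norm u \<le> \<delta> * norm y * norm u"
        by (intro mult_right_mono) auto
      with 1 show ?thesis by linarith
    qed simp
    with small show ?thesis by (simp add: dir_nhd_def)
  qed
  with \<kappa> T show thesis using that by blast
qed

lemma dir_nhd_mono: "\<epsilon> \<le> \<epsilon>' \<Longrightarrow> \<delta> \<le> \<delta>' \<Longrightarrow> dir_nhd \<epsilon> \<delta> u \<subseteq> dir_nhd \<epsilon>' \<delta>' u"
proof
  fix x assume le: "\<epsilon> \<le> \<epsilon>'" "\<delta> \<le> \<delta>'" and x: "x \<in> dir_nhd \<epsilon> \<delta> u"
  have "\<delta> * norm x * norm u \<le> \<delta>' * norm x * norm u"
    using le by (intro mult_right_mono) auto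
  then show "x \<in> dir_nhd \<epsilon>' \<delta>' u"
    using x le by (simp add: dir_nhd_def)
qed

text \<open>Apply calmness at \<open>x\<close> with \<open>\<alpha> = - pos_vec (\<phi> x)\<close>,
  the perturbation of least norm that makes \<open>x\<close> feasible. Its norm is at most
  \<open>L * norm (x - zb)\<close> because \<open>\<phi> zb\<close> lies in the orthant.\<close>

lemma calm_imp_exact_penalty:
  fixes \<phi> :: "'a::real_normed_vector \<Rightarrow> real ^ 'q"
  assumes feas: "\<phi> zb \<le> 0" and lip: "dir_lipschitz \<phi> zb u" and calm: "dir_calm f \<phi> zb u"
  obtains L \<rho> \<epsilon> \<delta> where "L > 0" "\<rho> > 0" "\<epsilon> > 0" "\<delta> > 0"
    "\<And>x y. x \<in> (+) zb ` dir_nhd \<epsilon> \<delta> u \<Longrightarrow> y \<in> (+) zb ` dir_nhd \<epsilon> \<delta> u \<Longrightarrow>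
      norm (\<phi> x - \<phi> y) \<le> L * norm (x - y)"
    "\<And>x. x \<in> (+) zb ` dir_nhd \<epsilon> \<delta> u \<Longrightarrow> f zb \<le> f x + \<rho> * norm (pos_vec (\<phi> x))"
proof -
  obtain L \<epsilon>1 \<delta>1 where L: "L > 0" and p1: "\<epsilon>1 > 0" "\<delta>1 > 0"
    and lip1: "\<And>x y. x \<in> (+) zb ` dir_nhd \<epsilon>1 \<delta>1 u \<Longrightarrow> y \<in> (+) zb ` dir_nhd \<epsilon>1 \<delta>1 u \<Longrightarrow>
      norm (\<phi> x - \<phi> y) \<le> L * norm (x - y)"
    using lip unfolding dir_lipschitz_def by metis
  obtain \<epsilon>2 \<delta>2 \<rho> where p2: "\<epsilon>2 > 0" "\<delta>2 > 0" and \<rho>: "\<rho> > 0"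
    and calm1: "\<And>\<alpha> z. \<alpha> \<in> ball 0 \<epsilon>2 \<Longrightarrow> z \<in> (+) zb ` dir_nhd \<epsilon>2 \<delta>2 u \<Longrightarrow>
      \<phi> z + \<alpha> \<le> 0 \<Longrightarrow> f z - f zb + \<rho> * norm \<alpha> \<ge> 0"
    using calm unfolding dir_calm_def by metis
  \<comment> \<open>The bound \<open>\<epsilon>2 / L\<close> makes the perturbation
    \<open>- pos_vec (\<phi> x)\<close> small enough for calmness.\<close>
  define \<epsilon> where "\<epsilon> = min \<epsilon>1 (min \<epsilon>2 (\<epsilon>2 / L))"
  define \<delta> where "\<delta> = min \<delta>1 \<delta>2"
  let ?W = "(+) zb ` dir_nhd \<epsilon> \<delta> u"
  have pos: "\<epsilon> > 0" "\<delta> > 0" using p1 p2 L by (auto simp: \<epsilon>_def \<delta>_def)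
  have W1: "?W \<subseteq> (+) zb ` dir_nhd \<epsilon>1 \<delta>1 u"
    by (intro image_mono dir_nhd_mono) (auto simp: \<epsilon>_def \<delta>_def)
  have W2: "?W \<subseteq> (+) zb ` dir_nhd \<epsilon>2 \<delta>2 u"
    by (intro image_mono dir_nhd_mono) (auto simp: \<epsilon>_def \<delta>_def)
  have zbW: "zb \<in> ?W"
    using pos by (auto simp: dir_nhd_def image_iff intro!: bexI[of _ 0])
  have "f zb \<le> f x + \<rho> * norm (pos_vec (\<phi> x))" if x: "x \<in> ?W" for x
  proof -
    have "norm (x - zb) < \<epsilon>" using x by (auto simp: dir_nhd_def)
    then have "norm (x - zb) < \<epsilon>2 / L" by (simp add: \<epsilon>_def)
    then have "L * norm (x - zb) < \<epsilon>2" using L by (simp add: field_simps)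
    moreover have "norm (pos_vec (\<phi> x)) \<le> L * norm (x - zb)"
      using norm_pos_vec_le_diff[OF feas, of "\<phi> x"] lip1[of x zb] x zbW W1
      by (meson order_trans subsetD)
    ultimately have "- pos_vec (\<phi> x) \<in> ball 0 \<epsilon>2" by simp
    moreover have "\<phi> x + - pos_vec (\<phi> x) \<le> 0"
      using pos_vec_ge[of "\<phi> x"] by simp
    ultimately have "f x - f zb + \<rho> * norm (- pos_vec (\<phi> x)) \<ge> 0"
      using calm1 x W2 by blast
    then show ?thesis by simp
  qed
  then show thesis
    using that[OF L \<rho> pos] lip1 W1 by (meson subsetD)
qed

section \<open>Gradient and first-order behaviour along \<open>u\<close>\<close>

lemma dir_differentiable_tendsto:
  assumes "dir_differentiable \<phi> z u"
  shows "((\<lambda>t. (\<phi> (z + t *\<^sub>R u) - \<phi> z) /\<^sub>R t) \<longlongrightarrow> dir_deriv \<phi> z u) (at_right 0)"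
proof -
  obtain d where d: "((\<lambda>t. (\<phi> (z + t *\<^sub>R u) - \<phi> z) /\<^sub>R t) \<longlongrightarrow> d) (at_right 0)"
    using assms unfolding dir_differentiable_def by blast
  then have "dir_deriv \<phi> z u = d"
    unfolding dir_deriv_def by (rule tendsto_Lim[OF trivial_limit_at_right_real])
  with d show ?thesis by simp
qed

text \<open>The critical cone is stated with derivatives of single components, the multiplier
  condition with the vector derivative; this links the two.\<close>

lemma dir_deriv_nth:
  fixes \<phi> :: "'a::real_normed_vector \<Rightarrow> real ^ 'q"
  assumes "dir_differentiable \<phi> z u"
  shows "dir_deriv (\<lambda>x. \<phi> x $ j) z u = dir_deriv \<phi> z u $ j"
proof -
  have "((\<lambda>t. (\<phi> (z + t *\<^sub>R u) $ j - \<phi> z $ j) /\<^sub>R t) \<longlongrightarrow> dir_deriv \<phi> z u $ j) (at_right 0)"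
    using tendsto_vec_nth[OF dir_differentiable_tendsto[OF assms], of j] by simp
  then show ?thesis
    unfolding dir_deriv_def[of "\<lambda>x. \<phi> x $ j"] by (rule tendsto_Lim[OF trivial_limit_at_right_real])
qed

text \<open>Existence comes from the Riesz representative \<open>adjoint F 1\<close> of the
  derivative \<open>F\<close>, uniqueness from that of the derivative; together they justify the
  \<open>THE\<close> in \<open>gradient\<close>.\<close>

lemma cont_differentiable_at_gderiv:
  assumes "cont_differentiable_at f z"
  shows "GDERIV f z :> gradient f z"
proof -
  have "f differentiable (at z)"
    using assms eventually_nhds_x_imp_x unfolding cont_differentiable_at_def by blast
  then obtain F where F: "(f has_derivative F) (at z)"
    by (auto simp: differentiable_def)
  then have "linear F" by (rule has_derivative_linear)
  then have "F = (\<lambda>h. h \<bullet> adjoint F 1)"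
    by (simp add: fun_eq_iff adjoint_works)
  then have g: "GDERIV f z :> adjoint F 1"
    using F unfolding gderiv_def by simp
  have "g1 = g2" if "GDERIV f z :> g1" "GDERIV f z :> g2" for g1 g2
    using has_derivative_unique[OF that[unfolded gderiv_def]]
    by (metis inner_commute vector_eq_rdot)
  with g show ?thesis
    unfolding gradient_def by (metis theI)
qed

text \<open>Constraint violation along the ray is \<open>o(t)\<close>. For active \<open>j\<close>
  the quotient tends to \<open>d $ j \<le> 0\<close>, so its positive part tends to 0; inactive
  components remain negative for small \<open>t\<close>.\<close>

lemma pos_vec_dir_small:
  fixes \<phi> :: "'a::real_normed_vector \<Rightarrow> real ^ 'q"
  assumes feas: "\<phi> zb \<le> 0"
    and d: "((\<lambda>t. (\<phi> (zb + t *\<^sub>R u) - \<phi> zb) /\<^sub>R t) \<longlongrightarrow> d) (at_right 0)"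
    and crit: "\<And>j. \<phi> zb $ j = 0 \<Longrightarrow> d $ j \<le> 0"
  shows "((\<lambda>t. norm (pos_vec (\<phi> (zb + t *\<^sub>R u))) / t) \<longlongrightarrow> 0) (at_right 0)"
proof -
  have pos: "\<forall>\<^sub>F t in at_right (0::real). t > 0"
    by (simp add: eventually_at_right_less)
  have comp: "((\<lambda>t. (pos_vec (\<phi> (zb + t *\<^sub>R u)) /\<^sub>R t) $ j) \<longlongrightarrow> 0) (at_right 0)" for j
  proof -
    have dj: "((\<lambda>t. (\<phi> (zb + t *\<^sub>R u) $ j - \<phi> zb $ j) / t) \<longlongrightarrow> d $ j) (at_right 0)"
      using tendsto_vec_nth[OF d, of j] by (simp add: divide_inverse_commute)
    show ?thesis
    proof (cases "\<phi> zb $ j = 0")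
      case True
      have "((\<lambda>t. max (\<phi> (zb + t *\<^sub>R u) $ j / t) 0) \<longlongrightarrow> max (d $ j) 0) (at_right 0)"
        using dj True by (intro tendsto_max tendsto_const) simp
      moreover have "max (d $ j) 0 = 0" using crit[OF True] by simp
      moreover have "\<forall>\<^sub>F t in at_right 0. max (\<phi> (zb + t *\<^sub>R u) $ j / t) 0
          = (pos_vec (\<phi> (zb + t *\<^sub>R u)) /\<^sub>R t) $ j"
        using pos by eventually_elim (auto simp: max_def field_simps)
      ultimately show ?thesis by (simp add: tendsto_cong)
    next
      case False
      then have neg: "\<phi> zb $ j < 0" using feas by (simp add: less_eq_vec_def order_less_le)
      \<comment> \<open>Continuity along the ray is extracted from convergence of the difference
        quotient.\<close>
      have "((\<lambda>t. t * ((\<phi> (zb + t *\<^sub>R u) $ j - \<phi> zb $ j) / t) + \<phi> zb $ j)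
          \<longlongrightarrow> 0 * d $ j + \<phi> zb $ j) (at_right 0)"
        by (intro tendsto_intros dj)
      then have "\<forall>\<^sub>F t in at_right 0. t * ((\<phi> (zb + t *\<^sub>R u) $ j - \<phi> zb $ j) / t) + \<phi> zb $ j < 0"
        using neg by (intro order_tendstoD(2)) auto
      with pos have "\<forall>\<^sub>F t in at_right 0. 0 = (pos_vec (\<phi> (zb + t *\<^sub>R u)) /\<^sub>R t) $ j"
        by eventually_elim simp
      then show ?thesis by (rule Lim_transform_eventually[OF tendsto_const])
    qed
  qed
  have "((\<lambda>t. pos_vec (\<phi> (zb + t *\<^sub>R u)) /\<^sub>R t) \<longlongrightarrow> 0) (at_right 0)"
    by (rule vec_tendstoI) (use comp in simp)
  then have "((\<lambda>t. norm (pos_vec (\<phi> (zb + t *\<^sub>R u)) /\<^sub>R t)) \<longlongrightarrow> 0) (at_right 0)"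
    by (rule tendsto_norm_zero)
  moreover have "\<forall>\<^sub>F t in at_right 0. norm (pos_vec (\<phi> (zb + t *\<^sub>R u)) /\<^sub>R t)
      = norm (pos_vec (\<phi> (zb + t *\<^sub>R u))) / t"
    using pos by eventually_elim (simp add: divide_inverse_commute)
  ultimately show ?thesis by (rule Lim_transform_eventually)
qed

section \<open>Approximate multipliers from the penalized problem\<close>

text \<open>Compare both sides with \<open>g \<bullet> zb\<close>. At the centre,
  \<open>g \<bullet> u \<le> 0\<close> and the \<open>o(t)\<close> violation leave an excess of at
  most \<open>\<theta> / 2 * t\<close>, smoothing cost \<open>\<rho> * t^2\<close> included. At
  \<open>x\<close>, linearizing \<open>f\<close> loses at most \<open>\<theta> / 2 * t\<close>, and
  exact penalization absorbs the rest.\<close>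

lemma penalized_gap:
  fixes f :: "'a::real_inner \<Rightarrow> real" and \<phi> :: "'a \<Rightarrow> real ^ 'q"
  assumes feas: "\<phi> zb \<le> 0" and g: "GDERIV f zb :> g" and gu: "g \<bullet> u \<le> 0"
    and d: "((\<lambda>t. (\<phi> (zb + t *\<^sub>R u) - \<phi> zb) /\<^sub>R t) \<longlongrightarrow> d) (at_right 0)"
    and crit: "\<And>j. \<phi> zb $ j = 0 \<Longrightarrow> d $ j \<le> 0"
    and \<rho>: "\<rho> > 0" and \<kappa>: "\<kappa> > 0" and \<theta>: "\<theta> > 0"
  shows "\<forall>\<^sub>F t in at_right 0. \<forall>x.
    norm (x - (zb + t *\<^sub>R u)) \<le> \<kappa> * t \<longrightarrow> f zb \<le> f x + \<rho> * norm (pos_vec (\<phi> x)) \<longrightarrow>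
    g \<bullet> (zb + t *\<^sub>R u) + \<rho> * smooth_penalty (t\<^sup>2) (\<phi> (zb + t *\<^sub>R u)) - \<theta> * t
      \<le> g \<bullet> x + \<rho> * smooth_penalty (t\<^sup>2) (\<phi> x)"
proof -
  \<comment> \<open>\<open>K * t\<close> bounds \<open>norm (x - zb)\<close>, so the first-order
    tolerance \<open>\<theta> / 2 / K\<close> yields the error
    \<open>\<theta> / 2 * t\<close>.\<close>
  define K where "K = norm u + \<kappa>"
  have K: "K > 0" using \<kappa> by (simp add: K_def add_nonneg_pos)
  have "\<theta> / 2 / K > 0" using \<theta> K by simp
  then obtain D where D: "D > 0"
    and fr: "\<And>x. norm (x - zb) < D \<Longrightarrow>
      norm (f x - f zb - (x - zb) \<bullet> g) \<le> \<theta> / 2 / K * norm (x - zb)"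
    using g unfolding gderiv_def has_derivative_at_alt by metis
  have "((\<lambda>t::real. \<rho> * (t + norm (pos_vec (\<phi> (zb + t *\<^sub>R u))) / t)) \<longlongrightarrow> \<rho> * (0 + 0)) (at_right 0)"
    by (intro tendsto_intros pos_vec_dir_small[OF feas d crit]) auto
  then have ev1: "\<forall>\<^sub>F t in at_right 0. \<rho> * (t + norm (pos_vec (\<phi> (zb + t *\<^sub>R u))) / t) < \<theta> / 2"
    using \<theta> by (intro order_tendstoD(2)) auto
  have ev2: "\<forall>\<^sub>F t in at_right (0::real). t < D / K"
    using D K by (intro order_tendstoD(2)[OF tendsto_ident_at]) auto
  have ev0: "\<forall>\<^sub>F t in at_right (0::real). t > 0"
    by (simp add: eventually_at_right_less)
  show ?thesis
    using ev0 ev1 ev2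
  proof eventually_elim
    case (elim t)
    let ?c = "zb + t *\<^sub>R u"
    show ?case
    proof (intro allI impI)
      fix x assume x: "norm (x - ?c) \<le> \<kappa> * t" and pen: "f zb \<le> f x + \<rho> * norm (pos_vec (\<phi> x))"
      have "norm (x - zb) \<le> norm (x - ?c) + norm (t *\<^sub>R u)"
        using norm_triangle_ineq[of "x - ?c" "t *\<^sub>R u"] by simp
      then have xK: "norm (x - zb) \<le> K * t"
        using x elim by (simp add: K_def algebra_simps)
      also have "\<dots> < D" using elim K by (simp add: field_simps)
      finally have "\<bar>f x - f zb - (x - zb) \<bullet> g\<bar> \<le> \<theta> / 2 / K * norm (x - zb)"
        using fr by simp
      also have "\<dots> \<le> \<theta> / 2 / K * (K * t)"
        using xK \<theta> K by (intro mult_left_mono) auto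
      also have "\<dots> = \<theta> / 2 * t" using K by simp
      finally have 1: "g \<bullet> x \<ge> g \<bullet> zb + f x - f zb - \<theta> / 2 * t"
        unfolding inner_commute[of _ g] inner_diff_right by linarith
      have 2: "\<rho> * smooth_penalty (t\<^sup>2) (\<phi> x) \<ge> \<rho> * norm (pos_vec (\<phi> x))"
        using smooth_penalty_ge \<rho> by (intro mult_left_mono) auto
      have "\<rho> * smooth_penalty (t\<^sup>2) (\<phi> ?c) \<le> \<rho> * (t\<^sup>2 + norm (pos_vec (\<phi> ?c)))"
        using smooth_penalty_le[of "t\<^sup>2"] \<rho> by (intro mult_left_mono) auto
      also have "\<dots> = \<rho> * (t + norm (pos_vec (\<phi> ?c)) / t) * t"
        using elim by (simp add: field_simps power2_eq_square)
      also have "\<dots> \<le> \<theta> / 2 * t"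
        using elim by (intro mult_right_mono) auto
      finally have 3: "\<rho> * smooth_penalty (t\<^sup>2) (\<phi> ?c) \<le> \<theta> / 2 * t" .
      have 4: "g \<bullet> ?c \<le> g \<bullet> zb"
        using gu elim by (simp add: inner_add_right mult_nonneg_nonpos)
      show "g \<bullet> ?c + \<rho> * smooth_penalty (t\<^sup>2) (\<phi> ?c) - \<theta> * t
          \<le> g \<bullet> x + \<rho> * smooth_penalty (t\<^sup>2) (\<phi> x)"
        using 1 2 3 4 pen by linarith
    qed
  qed
qed

text \<open>The multiplier is \<open>\<rho>\<close> times the gradient of the smoothed penalty at
  \<open>\<phi> z\<close>. Inserting the quadratic upper model into the proximal inequality for the
  penalized function leaves one for \<open>l \<bullet> \<phi>\<close> with slope
  \<open>w - g\<close>; the Lipschitz bound turns the model error into a multiple of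
  \<open>(norm (x - z))^2\<close>. Sign and support of \<open>l\<close> are those of
  \<open>pos_vec (\<phi> z)\<close>.\<close>

lemma penalized_proximal_multiplier:
  fixes \<phi> :: "'a::euclidean_space \<Rightarrow> real ^ 'q"
  assumes r: "r > 0" and m: "m > 0" and s: "s > 0" and \<rho>: "\<rho> > 0" and L: "L > 0"
    and lip: "\<And>x y. x \<in> cball c r \<Longrightarrow> y \<in> cball c r \<Longrightarrow> norm (\<phi> x - \<phi> y) \<le> L * norm (x - y)"
    and gap: "\<And>x. x \<in> cball c r \<Longrightarrow>
      g \<bullet> c + \<rho> * smooth_penalty s (\<phi> c) - m \<le> g \<bullet> x + \<rho> * smooth_penalty s (\<phi> x)"
  obtains z l \<xi> a where "z \<in> ball c r" "l \<ge> 0" "norm l \<le> \<rho>" "\<And>j. l $ j \<noteq> 0 \<Longrightarrow> \<phi> z $ j > 0"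
    "norm (\<xi> + g) \<le> 4 * m / r"
    "\<And>x. x \<in> cball c r \<Longrightarrow> l \<bullet> \<phi> x \<ge> l \<bullet> \<phi> z + \<xi> \<bullet> (x - z) - a * (norm (x - z))\<^sup>2"
proof -
  define \<psi> where "\<psi> = (\<lambda>x. g \<bullet> x + \<rho> * smooth_penalty s (\<phi> x))"
  have "L-lipschitz_on (cball c r) \<phi>"
    using lip L by (intro lipschitz_onI) (auto simp: dist_norm)
  then have "continuous_on (cball c r) \<phi>"
    by (rule lipschitz_on_continuous_on)
  then have cont: "continuous_on (cball c r) \<psi>"
    unfolding \<psi>_def smooth_penalty_def pos_vec_def by (intro continuous_intros)
  have gap\<psi>: "\<psi> c - m \<le> \<psi> x" if "x \<in> cball c r" for x
    using gap[OF that] by (simp add: \<psi>_def)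
  obtain z w a where z: "z \<in> ball c r" and w: "norm w \<le> 4 * m / r"
    and min: "\<And>x. x \<in> cball c r \<Longrightarrow> \<psi> x \<ge> \<psi> z + w \<bullet> (x - z) - a * (norm (x - z))\<^sup>2"
    by (rule approx_minimum_imp_proximal_subgradient[OF cont r m gap\<psi>])
      (assumption, rule that)
  let ?P = "smooth_penalty s (\<phi> z)"
  have P: "?P > 0" using smooth_penalty_ge_parameter[of s "\<phi> z"] s by linarith
  define l where "l = \<rho> *\<^sub>R (pos_vec (\<phi> z) /\<^sub>R ?P)"
  have lj: "l $ j = \<rho> * max (\<phi> z $ j) 0 / ?P" for j
    by (simp add: l_def divide_inverse_commute)
  have "l \<ge> 0" using P \<rho> by (simp add: less_eq_vec_def lj)
  moreover have "norm l \<le> \<rho>"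
    using P \<rho> smooth_penalty_ge[of "\<phi> z" s] by (simp add: l_def field_simps)
  moreover have "\<phi> z $ j > 0" if "l $ j \<noteq> 0" for j
    using that by (auto simp: lj max_def split: if_splits)
  moreover have "norm ((w - g) + g) \<le> 4 * m / r" using w by simp
  moreover have "l \<bullet> \<phi> x \<ge> l \<bullet> \<phi> z + (w - g) \<bullet> (x - z)
      - (a + \<rho> * L\<^sup>2 / (2 * s)) * (norm (x - z))\<^sup>2" if x: "x \<in> cball c r" for x
  proof -
    have "norm (\<phi> x - \<phi> z) \<le> L * norm (x - z)" using lip x z by simp
    then have "(norm (\<phi> x - \<phi> z))\<^sup>2 \<le> L\<^sup>2 * (norm (x - z))\<^sup>2"
      by (metis norm_ge_zero power_mono power_mult_distrib)
    then have "(norm (\<phi> x - \<phi> z))\<^sup>2 / (2 * s) \<le> L\<^sup>2 * (norm (x - z))\<^sup>2 / (2 * s)"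
      using s by (intro divide_right_mono) auto
    then have "smooth_penalty s (\<phi> x) \<le> ?P + (pos_vec (\<phi> z) /\<^sub>R ?P) \<bullet> (\<phi> x - \<phi> z)
        + L\<^sup>2 * (norm (x - z))\<^sup>2 / (2 * s)"
      using smooth_penalty_upper[OF s, of "\<phi> x" "\<phi> z"] by linarith
    then have "\<rho> * smooth_penalty s (\<phi> x) \<le> \<rho> * (?P + (pos_vec (\<phi> z) /\<^sub>R ?P) \<bullet> (\<phi> x - \<phi> z)
        + L\<^sup>2 * (norm (x - z))\<^sup>2 / (2 * s))"
      using \<rho> by (intro mult_left_mono) auto
    also have "\<dots> = \<rho> * ?P + l \<bullet> (\<phi> x - \<phi> z) + \<rho> * L\<^sup>2 / (2 * s) * (norm (x - z))\<^sup>2"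
      unfolding l_def by (simp add: distrib_left)
    finally show ?thesis
      using min[OF x] unfolding \<psi>_def by (simp add: algebra_simps)
  qed
  ultimately show thesis
    using that[OF z] by blast
qed

lemma approximate_directional_multiplier:
  fixes f :: "'a::euclidean_space \<Rightarrow> real" and \<phi> :: "'a \<Rightarrow> real ^ 'q"
  assumes feas: "\<phi> zb \<le> 0" and g: "GDERIV f zb :> g" and gu: "g \<bullet> u \<le> 0"
    and d: "((\<lambda>t. (\<phi> (zb + t *\<^sub>R u) - \<phi> zb) /\<^sub>R t) \<longlongrightarrow> d) (at_right 0)"
    and crit: "\<And>j. \<phi> zb $ j = 0 \<Longrightarrow> d $ j \<le> 0"
    and L: "L > 0" and \<rho>: "\<rho> > 0" and \<kappa>: "\<kappa> > 0" and T: "T > 0"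
    and W: "\<And>t x. 0 < t \<Longrightarrow> t < T \<Longrightarrow> norm (x - (zb + t *\<^sub>R u)) \<le> \<kappa> * t \<Longrightarrow> x \<in> W"
    and lip: "\<And>x y. x \<in> W \<Longrightarrow> y \<in> W \<Longrightarrow> norm (\<phi> x - \<phi> y) \<le> L * norm (x - y)"
    and pen: "\<And>x. x \<in> W \<Longrightarrow> f zb \<le> f x + \<rho> * norm (pos_vec (\<phi> x))"
    and \<eta>: "\<eta> > 0"
  obtains t z l \<xi> r a where "0 < t" "t < \<eta>" "zb + t *\<^sub>R u \<in> W" "norm (z - (zb + t *\<^sub>R u)) \<le> \<eta> * t"
    "r > 0" "cball z r \<subseteq> W" "l \<ge> 0" "norm l \<le> \<rho>" "\<And>j. l $ j \<noteq> 0 \<Longrightarrow> \<phi> z $ j > 0"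
    "norm (\<xi> + g) \<le> \<eta>"
    "\<And>x. x \<in> cball z r \<Longrightarrow> l \<bullet> \<phi> x \<ge> l \<bullet> \<phi> z + \<xi> \<bullet> (x - z) - a * (norm (x - z))\<^sup>2"
proof -
  define \<sigma> where "\<sigma> = min \<eta> \<kappa>"
  have \<sigma>: "\<sigma> > 0" "\<sigma> \<le> \<eta>" "\<sigma> \<le> \<kappa>" using \<eta> \<kappa> by (auto simp: \<sigma>_def)
  \<comment> \<open>On a ball of radius \<open>\<sigma> * t\<close> with gap
    \<open>\<theta> * t\<close> the tilt is at most \<open>4 * \<theta> / \<sigma>\<close>; this
    choice makes it \<open>\<eta>\<close>.\<close>
  define \<theta> where "\<theta> = \<sigma> * \<eta> / 4"
  have \<theta>: "\<theta> > 0" using \<sigma> \<eta> by (simp add: \<theta>_def)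
  have ev: "\<forall>\<^sub>F t in at_right (0::real). t > 0 \<and> t < min T \<eta>"
    using T \<eta> by (intro eventually_conj eventually_at_right_less order_tendstoD(2)[OF tendsto_ident_at]) auto
  obtain t where t: "0 < t" "t < T" "t < \<eta>"
    and gap: "\<And>x. norm (x - (zb + t *\<^sub>R u)) \<le> \<sigma> * t \<Longrightarrow> f zb \<le> f x + \<rho> * norm (pos_vec (\<phi> x)) \<Longrightarrow>
      g \<bullet> (zb + t *\<^sub>R u) + \<rho> * smooth_penalty (t\<^sup>2) (\<phi> (zb + t *\<^sub>R u)) - \<theta> * t
      \<le> g \<bullet> x + \<rho> * smooth_penalty (t\<^sup>2) (\<phi> x)"
    using eventually_happens'[OF trivial_limit_at_right_real
        eventually_conj[OF ev penalized_gap[OF feas g gu d crit \<rho> \<sigma>(1) \<theta>]]]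
    by auto
  define c where "c = zb + t *\<^sub>R u"
  have cW: "cball c (\<sigma> * t) \<subseteq> W"
  proof
    fix x assume "x \<in> cball c (\<sigma> * t)"
    then have "norm (x - c) \<le> \<sigma> * t" by (simp add: dist_norm norm_minus_commute)
    also have "\<dots> \<le> \<kappa> * t" using \<sigma> t by simp
    finally show "x \<in> W" using W t unfolding c_def by blast
  qed
  have pos: "\<sigma> * t > 0" "\<theta> * t > 0" "t\<^sup>2 > 0" using \<sigma> \<theta> t by auto
  have lip': "norm (\<phi> x - \<phi> y) \<le> L * norm (x - y)"
    if "x \<in> cball c (\<sigma> * t)" "y \<in> cball c (\<sigma> * t)" for x y
    using lip cW that by blast
  have gap': "g \<bullet> c + \<rho> * smooth_penalty (t\<^sup>2) (\<phi> c) - \<theta> * t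
      \<le> g \<bullet> x + \<rho> * smooth_penalty (t\<^sup>2) (\<phi> x)" if "x \<in> cball c (\<sigma> * t)" for x
    using gap[of x] pen[of x] cW that
    by (auto simp: c_def dist_norm norm_minus_commute)
  obtain z l \<xi> a where z: "z \<in> ball c (\<sigma> * t)"
    and l: "l \<ge> 0" "norm l \<le> \<rho>" "\<And>j. l $ j \<noteq> 0 \<Longrightarrow> \<phi> z $ j > 0"
    and \<xi>: "norm (\<xi> + g) \<le> 4 * (\<theta> * t) / (\<sigma> * t)"
    and prox: "\<And>x. x \<in> cball c (\<sigma> * t) \<Longrightarrow>
      l \<bullet> \<phi> x \<ge> l \<bullet> \<phi> z + \<xi> \<bullet> (x - z) - a * (norm (x - z))\<^sup>2"
    by (rule penalized_proximal_multiplier[OF pos \<rho> L lip' gap'])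
      (assumption+, rule that)
  have \<xi>': "norm (\<xi> + g) \<le> \<eta>" using \<xi> \<sigma> t by (simp add: \<theta>_def)
  obtain r where r: "r > 0" "cball z r \<subseteq> ball c (\<sigma> * t)"
    using z open_ball[of c "\<sigma> * t"] by (meson open_contains_cball)
  have "norm (z - c) \<le> \<eta> * t"
  proof -
    have "norm (z - c) \<le> \<sigma> * t" using z by (simp add: dist_norm norm_minus_commute)
    also have "\<dots> \<le> \<eta> * t" using \<sigma> t by simp
    finally show ?thesis .
  qed
  moreover have "c \<in> W" using cW pos by auto
  moreover have "cball z r \<subseteq> W" using r(2) ball_subset_cball cW by blast
  moreover have "l \<bullet> \<phi> x \<ge> l \<bullet> \<phi> z + \<xi> \<bullet> (x - z) - a * (norm (x - z))\<^sup>2" if "x \<in> cball z r" for x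
    using prox[of x] r(2) that by auto
  ultimately show thesis
    using that[OF t(1,3) _ _ r(1) _ l \<xi>'] unfolding c_def by blast
qed

section \<open>Passage to the limit\<close>

theorem theorem3p1:
  fixes f :: "real ^ 'n \<Rightarrow> real"
    and \<phi> :: "real ^ 'n \<Rightarrow> real ^ 'q"
    and zb u :: "real ^ 'n"
  assumes "local_minimizer f \<phi> zb"
    and "cont_differentiable_at f zb"
    and "dir_lipschitz \<phi> zb u"
    and "dir_differentiable \<phi> zb u"
    and "u \<in> critical_cone f \<phi> zb"
    and "dir_calm f \<phi> zb u"
  shows "\<exists>l :: real ^ 'q. l \<ge> 0 \<and> l \<bullet> \<phi> zb = 0 \<and> l \<bullet> dir_deriv \<phi> zb u = 0 \<and>
           0 \<in> (+) (gradient f zb) ` dir_limiting_subdiff (\<lambda>z. l \<bullet> \<phi> z) zb u"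
proof -
  define g where "g = gradient f zb"
  define d where "d = dir_deriv \<phi> zb u"
  have feas: "\<phi> zb \<le> 0" using assms(1) by (simp add: local_minimizer_def)
  have g: "GDERIV f zb :> g"
    using cont_differentiable_at_gderiv assms(2) by (simp add: g_def)
  have gu: "g \<bullet> u \<le> 0" using assms(5) by (simp add: critical_cone_def g_def)
  have d: "((\<lambda>t. (\<phi> (zb + t *\<^sub>R u) - \<phi> zb) /\<^sub>R t) \<longlongrightarrow> d) (at_right 0)"
    using dir_differentiable_tendsto[OF assms(4)] by (simp add: d_def)
  have crit: "d $ j \<le> 0" if "\<phi> zb $ j = 0" for j
    using assms(5) that dir_deriv_nth[OF assms(4), of j]
    by (auto simp: critical_cone_def active_set_def d_def)
  obtain L \<rho> \<epsilon> \<delta> where L: "L > 0" and \<rho>: "\<rho> > 0" and \<epsilon>: "\<epsilon> > 0" "\<delta> > 0"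
    and lip: "\<And>x y. x \<in> (+) zb ` dir_nhd \<epsilon> \<delta> u \<Longrightarrow> y \<in> (+) zb ` dir_nhd \<epsilon> \<delta> u \<Longrightarrow>
      norm (\<phi> x - \<phi> y) \<le> L * norm (x - y)"
    and pen: "\<And>x. x \<in> (+) zb ` dir_nhd \<epsilon> \<delta> u \<Longrightarrow> f zb \<le> f x + \<rho> * norm (pos_vec (\<phi> x))"
    using calm_imp_exact_penalty[OF feas assms(3,6)] by metis
  define W where "W = (+) zb ` dir_nhd \<epsilon> \<delta> u"
  note lip = lip[folded W_def] and pen = pen[folded W_def]
  have zbW: "zb \<in> W"
    using \<epsilon> by (auto simp: W_def dir_nhd_def image_iff intro!: bexI[of _ 0])
  obtain \<kappa> T where \<kappa>: "\<kappa> > 0" and T: "T > 0"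
    and cone: "\<And>t y. 0 < t \<Longrightarrow> t < T \<Longrightarrow> norm (y - t *\<^sub>R u) \<le> \<kappa> * t \<Longrightarrow> y \<in> dir_nhd \<epsilon> \<delta> u"
    using cone_subset_dir_nhd[OF \<epsilon>] by metis
  have W: "x \<in> W" if "0 < t" "t < T" "norm (x - (zb + t *\<^sub>R u)) \<le> \<kappa> * t" for t x
  proof -
    have "x - zb \<in> dir_nhd \<epsilon> \<delta> u" using cone[of t "x - zb"] that by (simp add: diff_diff_eq)
    then show ?thesis unfolding W_def by (intro image_eqI[of x _ "x - zb"]) auto
  qed
  \<comment> \<open>Bundling all properties into one predicate lets a single choice produce the six
    sequences together.\<close>
  define A where "A \<eta> t z l \<xi> r a \<longleftrightarrow> 0 < t \<and> t < \<eta> \<and> zb + t *\<^sub>R u \<in> W \<and>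
    norm (z - (zb + t *\<^sub>R u)) \<le> \<eta> * t \<and> r > 0 \<and> cball z r \<subseteq> W \<and> l \<ge> 0 \<and> norm l \<le> \<rho> \<and>
    (\<forall>j. l $ j \<noteq> 0 \<longrightarrow> \<phi> z $ j > 0) \<and> norm (\<xi> + g) \<le> \<eta> \<and>
    (\<forall>x\<in>cball z r. l \<bullet> \<phi> x \<ge> l \<bullet> \<phi> z + \<xi> \<bullet> (x - z) - a * (norm (x - z))\<^sup>2)"
    for \<eta> t r a :: real and z \<xi> and l :: "real ^ 'q"
  have "\<exists>t z l \<xi> r a. A \<eta> t z l \<xi> r a" if "\<eta> > 0" for \<eta>
  proof (rule approximate_directional_multiplier[OF feas g gu d crit L \<rho> \<kappa> T W lip pen that])
    fix t z l \<xi> r a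
    assume "0 < t" "t < \<eta>" "zb + t *\<^sub>R u \<in> W" "norm (z - (zb + t *\<^sub>R u)) \<le> \<eta> * t"
      "r > 0" "cball z r \<subseteq> W" "l \<ge> 0" "norm l \<le> \<rho>" "\<And>j. l $ j \<noteq> 0 \<Longrightarrow> \<phi> z $ j > 0"
      "norm (\<xi> + g) \<le> \<eta>"
      "\<And>x. x \<in> cball z r \<Longrightarrow> l \<bullet> \<phi> x \<ge> l \<bullet> \<phi> z + \<xi> \<bullet> (x - z) - a * (norm (x - z))\<^sup>2"
    then have "A \<eta> t z l \<xi> r a" unfolding A_def by blast
    then show ?thesis by blast
  qed
  then have "\<forall>k. \<exists>t z l \<xi> r a. A (inverse (real (Suc k))) t z l \<xi> r a"
    by simp
  then obtain t z l \<xi> r a where A: "\<And>k. A (inverse (real (Suc k))) (t k) (z k) (l k) (\<xi> k) (r k) (a k)"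
    by metis
  have
    t: "\<And>k. 0 < t k" "\<And>k. t k < inverse (real (Suc k))"
    and cW: "\<And>k. zb + t k *\<^sub>R u \<in> W"
    and z: "\<And>k. norm (z k - (zb + t k *\<^sub>R u)) \<le> inverse (real (Suc k)) * t k"
    and r: "\<And>k. r k > 0" "\<And>k. cball (z k) (r k) \<subseteq> W"
    and l: "\<And>k. l k \<ge> 0" "\<And>k. norm (l k) \<le> \<rho>" "\<And>k j. l k $ j \<noteq> 0 \<Longrightarrow> \<phi> (z k) $ j > 0"
    and \<xi>: "\<And>k. norm (\<xi> k + g) \<le> inverse (real (Suc k))"
    and prox: "\<And>k x. x \<in> cball (z k) (r k) \<Longrightarrow>
      l k \<bullet> \<phi> x \<ge> l k \<bullet> \<phi> (z k) + \<xi> k \<bullet> (x - z k) - a k * (norm (x - z k))\<^sup>2"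
    using A unfolding A_def by blast+
  \<comment> \<open>The uniform bound \<open>\<rho>\<close> gives compactness; \<open>l'\<close> is
    the multiplier sought.\<close>
  have "bounded (range l)" using l(2) by (auto simp: bounded_iff)
  then obtain l' h where h: "strict_mono h" and lh: "(l \<circ> h) \<longlonglongrightarrow> l'"
    using bounded_imp_convergent_subsequence by blast
  have inv0: "(\<lambda>k. inverse (real (Suc (h k)))) \<longlonglongrightarrow> 0"
    using LIMSEQ_subseq_LIMSEQ[OF LIMSEQ_inverse_real_of_nat h] by (simp add: o_def)
  have th0: "(\<lambda>k. t (h k)) \<longlonglongrightarrow> 0"
    by (rule tendsto_sandwich[OF _ _ tendsto_const inv0])
      (auto intro!: always_eventually less_imp_le t simp del: of_nat_Suc)
  have th: "filterlim (\<lambda>k. t (h k)) (at_right 0) sequentially"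
    using th0 t(1) by (auto simp: filterlim_at order_less_imp_not_eq2 intro!: always_eventually)
  \<comment> \<open>The points \<open>z (h k)\<close> leave the ray only by
    \<open>o(t (h k))\<close>, so the Lipschitz bound gives the quotients the same limit as on the
    ray.\<close>
  have quot: "(\<lambda>k. (\<phi> (z (h k)) - \<phi> zb) /\<^sub>R t (h k)) \<longlonglongrightarrow> d"
  proof -
    have 1: "(\<lambda>k. (\<phi> (zb + t (h k) *\<^sub>R u) - \<phi> zb) /\<^sub>R t (h k)) \<longlonglongrightarrow> d"
      by (rule filterlim_compose[OF d th])
    have "(\<lambda>k. (\<phi> (z (h k)) - \<phi> (zb + t (h k) *\<^sub>R u)) /\<^sub>R t (h k)) \<longlonglongrightarrow> 0"
    proof (rule Lim_null_comparison)
      show "(\<lambda>k. L * inverse (real (Suc (h k)))) \<longlonglongrightarrow> 0"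
        using tendsto_mult_left[OF inv0, of L] by simp
      have "norm ((\<phi> (z k) - \<phi> (zb + t k *\<^sub>R u)) /\<^sub>R t k) \<le> L * inverse (real (Suc k))" for k
      proof -
        have "z k \<in> W" using r[of k] by (meson centre_in_cball less_imp_le subsetD)
        then have "norm (\<phi> (z k) - \<phi> (zb + t k *\<^sub>R u)) \<le> L * norm (z k - (zb + t k *\<^sub>R u))"
          using lip cW by blast
        also have "\<dots> \<le> L * (inverse (real (Suc k)) * t k)"
          using z L by (intro mult_left_mono) auto
        finally have *: "norm (\<phi> (z k) - \<phi> (zb + t k *\<^sub>R u)) \<le> L * inverse (real (Suc k)) * t k"
          by (simp only: mult.assoc)
        have "norm ((\<phi> (z k) - \<phi> (zb + t k *\<^sub>R u)) /\<^sub>R t k)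
            = norm (\<phi> (z k) - \<phi> (zb + t k *\<^sub>R u)) / t k"
          using t(1)[of k] by (simp add: divide_inverse_commute)
        with * show ?thesis
          using t(1)[of k] by (simp only: pos_divide_le_eq)
      qed
      then show "\<forall>\<^sub>F k in sequentially. norm ((\<phi> (z (h k)) - \<phi> (zb + t (h k) *\<^sub>R u)) /\<^sub>R t (h k))
          \<le> L * inverse (real (Suc (h k)))"
        by (intro always_eventually allI)
    qed
    from tendsto_add[OF 1 this] show ?thesis
      by (simp add: algebra_simps)
  qed
  have \<phi>z: "(\<lambda>k. \<phi> (z (h k))) \<longlonglongrightarrow> \<phi> zb"
  proof -
    have "(\<lambda>k. t (h k) *\<^sub>R ((\<phi> (z (h k)) - \<phi> zb) /\<^sub>R t (h k)) + \<phi> zb) \<longlonglongrightarrow> 0 *\<^sub>R d + \<phi> zb"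
      by (intro tendsto_intros th0 quot)
    moreover have "t (h k) *\<^sub>R ((\<phi> (z (h k)) - \<phi> zb) /\<^sub>R t (h k)) + \<phi> zb = \<phi> (z (h k))" for k
      using t(1)[of "h k"] by simp
    ultimately show ?thesis by simp
  qed
  have l'0: "l' \<ge> 0"
    unfolding less_eq_vec_def
  proof
    fix j
    show "0 $ j \<le> l' $ j"
      by (rule tendsto_lowerbound[OF tendsto_vec_nth[OF lh]])
        (use l(1) in \<open>auto simp: less_eq_vec_def intro!: always_eventually\<close>)
  qed
  \<comment> \<open>If \<open>l' $ j\<close> is nonzero, then eventually
    \<open>\<phi> (z (h k)) $ j > 0\<close>. The limit forces \<open>j\<close> to be active; the
    quotients are then nonnegative, so \<open>d $ j \<ge> 0\<close>, and criticality gives the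
    reverse inequality.\<close>
  have compl: "\<phi> zb $ j = 0 \<and> d $ j = 0" if "l' $ j \<noteq> 0" for j
  proof -
    have "\<forall>\<^sub>F k in sequentially. (l \<circ> h) k $ j \<noteq> 0"
      by (rule tendsto_imp_eventually_ne[OF tendsto_vec_nth[OF lh] that])
    then have ev: "\<forall>\<^sub>F k in sequentially. \<phi> (z (h k)) $ j > 0"
      by eventually_elim (use l(3) in auto)
    then have "\<phi> zb $ j \<ge> 0"
      by (intro tendsto_lowerbound[OF tendsto_vec_nth[OF \<phi>z]]) (auto elim: eventually_mono)
    then have act: "\<phi> zb $ j = 0" using feas by (simp add: less_eq_vec_def order_antisym)
    have "\<forall>\<^sub>F k in sequentially. ((\<phi> (z (h k)) - \<phi> zb) /\<^sub>R t (h k)) $ j \<ge> 0"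
      using ev by eventually_elim (use t(1) act in \<open>auto intro!: mult_nonneg_nonneg less_imp_le\<close>)
    then have "d $ j \<ge> 0"
      by (intro tendsto_lowerbound[OF tendsto_vec_nth[OF quot]]) auto
    with crit[OF act] act show ?thesis by simp
  qed
  have "l' \<bullet> \<phi> zb = 0" "l' \<bullet> d = 0"
    unfolding inner_vec_def by (rule sum.neutral, use compl in force)+
  moreover have "- g \<in> dir_limiting_subdiff (\<lambda>x. l' \<bullet> \<phi> x) zb u"
  proof -
    \<comment> \<open>The limiting subdifferential concerns the fixed function
      \<open>l' \<bullet> \<phi>\<close>, so the multipliers \<open>l (h k)\<close> must be
      exchanged for \<open>l'\<close>. The factor \<open>t (h k)\<close> keeps the resulting shift
      of the points negligible after division by \<open>t (h k)\<close>, so the directions still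
      tend to \<open>u\<close>.\<close>
    define e where "e k = inverse (real (Suc (h k))) * t (h k)" for k
    have "\<exists>z' \<xi>'. z' \<in> cball (z (h k)) (r (h k)) \<and> norm (z' - z (h k)) \<le> e k \<and>
      norm (\<xi>' - \<xi> (h k)) \<le> e k + 4 * L * norm (l' - l (h k)) \<and>
      \<xi>' \<in> regular_subdiff (\<lambda>x. l' \<bullet> \<phi> x) z'" for k
    proof -
      have e: "e k > 0" using t(1) by (simp add: e_def)
      have lip': "norm (\<phi> x - \<phi> y) \<le> L * norm (x - y)"
        if "x \<in> cball (z (h k)) (r (h k))" "y \<in> cball (z (h k)) (r (h k))" for x y
        using lip r(2) that by blast
      show ?thesis
        by (rule proximal_change_multiplier[OF r(1) e L lip' prox])
          (assumption+, intro exI conjI)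
    qed
    then obtain z' \<xi>' where z': "\<And>k. z' k \<in> cball (z (h k)) (r (h k))"
        "\<And>k. norm (z' k - z (h k)) \<le> e k"
      and \<xi>': "\<And>k. norm (\<xi>' k - \<xi> (h k)) \<le> e k + 4 * L * norm (l' - l (h k))"
      and sub: "\<And>k. \<xi>' k \<in> regular_subdiff (\<lambda>x. l' \<bullet> \<phi> x) (z' k)"
      by metis
    have e0: "e \<longlonglongrightarrow> 0"
      using tendsto_mult[OF inv0 th0] by (simp add: e_def[abs_def])
    define v where "v k = (z' k - zb) /\<^sub>R t (h k)" for k
    have zv: "zb + t (h k) *\<^sub>R v k = z' k" for k
      using t(1)[of "h k"] by (simp add: v_def)
    have v: "v \<longlonglongrightarrow> u"
    proof (rule LIM_zero_cancel, rule Lim_null_comparison)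
      show "(\<lambda>k. 2 * inverse (real (Suc (h k)))) \<longlonglongrightarrow> 0"
        using tendsto_mult_left[OF inv0, of 2] by simp
      have "norm (v k - u) \<le> 2 * inverse (real (Suc (h k)))" for k
      proof -
        have "t (h k) *\<^sub>R (v k - u) = (z' k - z (h k)) + (z (h k) - (zb + t (h k) *\<^sub>R u))"
          using zv[of k] by (simp add: algebra_simps)
        then have "norm (t (h k) *\<^sub>R (v k - u)) \<le> e k + e k"
          using norm_triangle_mono[OF z'(2)[of k] z[of "h k", folded e_def]] by metis
        then show ?thesis
          using t(1)[of "h k"] by (simp add: e_def)
      qed
      then show "\<forall>\<^sub>F k in sequentially. norm (v k - u) \<le> 2 * inverse (real (Suc (h k)))"
        by simp
    qed
    \<comment> \<open>Three errors add up: the localizer tolerance, the change of multiplier, which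
      vanishes since \<open>l \<circ> h\<close> tends to \<open>l'\<close>, and the distance of
      \<open>\<xi> (h k)\<close> from \<open>- g\<close>.\<close>
    have "\<xi>' \<longlonglongrightarrow> - g"
    proof (rule LIM_zero_cancel, rule Lim_null_comparison)
      have "(\<lambda>k. l' - l (h k)) \<longlonglongrightarrow> 0"
        using tendsto_diff[OF tendsto_const[of l'] lh] by (simp add: o_def)
      then have "(\<lambda>k. e k + 4 * L * norm (l' - l (h k)) + inverse (real (Suc (h k))))
          \<longlonglongrightarrow> 0 + 4 * L * 0 + 0"
        by (intro tendsto_add tendsto_mult tendsto_const e0 inv0 tendsto_norm_zero)
      then show "(\<lambda>k. e k + 4 * L * norm (l' - l (h k)) + inverse (real (Suc (h k)))) \<longlonglongrightarrow> 0"
        by simp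
      have "norm (\<xi>' k - - g) \<le> e k + 4 * L * norm (l' - l (h k)) + inverse (real (Suc (h k)))" for k
        using norm_triangle_mono[OF \<xi>'[of k] \<xi>[of "h k"]] by simp
      then show "\<forall>\<^sub>F k in sequentially. norm (\<xi>' k - - g)
          \<le> e k + 4 * L * norm (l' - l (h k)) + inverse (real (Suc (h k)))"
        by simp
    qed
    \<comment> \<open>Both \<open>zb\<close> and the points \<open>z' k\<close> lie in
      \<open>W\<close>, so the directional Lipschitz bound supplies the convergence of
      values.\<close>
    moreover have "(\<lambda>k. l' \<bullet> \<phi> (zb + t (h k) *\<^sub>R v k)) \<longlonglongrightarrow> l' \<bullet> \<phi> zb"
    proof (intro tendsto_inner tendsto_const, rule LIM_zero_cancel, rule Lim_null_comparison)
      have "(\<lambda>k. L * norm (t (h k) *\<^sub>R v k)) \<longlonglongrightarrow> L * norm (0 *\<^sub>R u)"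
        by (intro tendsto_intros th0 v)
      then show "(\<lambda>k. L * norm (t (h k) *\<^sub>R v k)) \<longlonglongrightarrow> 0" by simp
      have "norm (\<phi> (zb + t (h k) *\<^sub>R v k) - \<phi> zb) \<le> L * norm (t (h k) *\<^sub>R v k)" for k
        using lip[of "zb + t (h k) *\<^sub>R v k" zb] z'(1)[of k] r(2)[of "h k"] zbW zv[of k]
        by (metis add_diff_cancel_left' subsetD)
      then show "\<forall>\<^sub>F k in sequentially. norm (\<phi> (zb + t (h k) *\<^sub>R v k) - \<phi> zb)
          \<le> L * norm (t (h k) *\<^sub>R v k)"
        by simp
    qed
    ultimately show ?thesis
      unfolding dir_limiting_subdiff_def mem_Collect_eq
      by (intro exI[of _ "\<lambda>k. t (h k)"] exI[of _ v] exI[of _ \<xi>'] conjI allI t(1) th0 v)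
        (simp_all add: zv sub)
  qed
  then have "0 \<in> (+) g ` dir_limiting_subdiff (\<lambda>x. l' \<bullet> \<phi> x) zb u"
    by (auto simp: image_iff intro!: bexI[of _ "- g"])
  ultimately show ?thesis
    using l'0 unfolding g_def d_def by blast
qed

end
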